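(* Let $K$ be a convex body in $\mathbb{R}^3$, and for $p\in\mathrm{bd}K$ let $\theta_p$ denote the complete angle of $\mathrm{bd}K$ at $p$. (i) Any point $x\in\mathrm{bd}K$ with $\theta_x\le 2\pi/3$ is a diametral point of $K$. If $x\ne y$ are two points of $\mathrm{bd}K$ with $\theta_x\le 2\pi/3$ and $\theta_y\le 2\pi/3$, then the line-segment $xy$ is a diameter of $K$. (ii) If $x,y\in\mathrm{bd}K$ are two distinct points with $\theta_x+\theta_y\le 3\pi/2$, then at least one of $x,y$ is a diametral point of $K$. (iii) If $x,y,z\in\mathrm{bd}K$ are three distinct points with $\theta_x+\theta_y+\theta_z\le 9\pi/4$, then at least one of $x,y,z$ is a diametral point of $K$.
   Context: A convex body in $\mathbb{R}^3$ is a compact convex subset of $\mathbb{R}^3$ with non-empty interior; $\mathrm{bd}K$ is its boundary. For $p\in \mathrm{bd}K$, the tangent cone $T_p$ is the limit surface of the homothetic dilations of $\mathrm{bd}K$ with centre $p$ and coefficients tending to infinity (equivalently, the boundary of the closure of $\{p+t(q-p): q\in K,\ t\ge 0\}$). The cone $T_p$ can be unfolded in the plane, producing an angle whose measure is the complete angle $\theta_p\in(0,2\pi]$ at $p$ (equivalently, $\theta_p$ is the length of the curve in which $T_p$ meets the unit sphere centred at $p$). A diameter of $K$ is a line-segment in $K$ whose length equals the maximal Euclidean distance between pairs of points of $K$. A diametral point of $K$ is an endpoint of some diameter of $K$. *)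

theory Defs
  imports "HOL-Analysis.Analysis"
begin

definition convex_body :: "(real^3) set \<Rightarrow> bool" where
  "convex_body K \<longleftrightarrow> compact K \<and> convex K \<and> interior K \<noteq> {}"

text \<open>The tangent cone is the boundary surface of the solid cone with apex \<open>p\<close>.\<close>

definition tangent_cone :: "(real^3) set \<Rightarrow> real^3 \<Rightarrow> (real^3) set" where
  "tangent_cone K p =
     frontier (closure {p + t *\<^sub>R (q - p) | q t. q \<in> K \<and> 0 \<le> t})"

text \<open>Length of a path as the supremum of the lengths of the inscribed polygonal lines.\<close>

definition path_length :: "(real \<Rightarrow> 'a::metric_space) \<Rightarrow> ennreal" where
  "path_length g =
     (SUP (n, t) \<in> {(n::nat, t::nat \<Rightarrow> real). mono_on {..n} t \<and> t ` {..n} \<subseteq> {0..1}}.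
        ennreal (\<Sum>i<n. dist (g (t i)) (g (t (Suc i)))))"

text \<open>
  Length of a Jordan curve given as a point set. All simple closed parametrizations of the same
  curve have the same length, so the infimum is over a single value and only serves to avoid
  choosing a parametrization.
\<close>

definition jordan_curve_length :: "'a::metric_space set \<Rightarrow> ennreal" where
  "jordan_curve_length C =
     (INF g \<in> {g. simple_path g \<and> pathfinish g = pathstart g \<and> path_image g = C}. path_length g)"

text \<open>
  The angle obtained by unfolding the tangent cone into the plane is the length of its
  intersection with the unit sphere centred at the apex. For a convex body \<open>K\<close> and a boundary
  point \<open>p\<close> this intersection is a Jordan curve.
\<close>

definition complete_angle :: "(real^3) set \<Rightarrow> real^3 \<Rightarrow> ennreal" where
  "complete_angle K p = jordan_curve_length (tangent_cone K p \<inter> sphere p 1)"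

text \<open>The segment with endpoints \<open>x\<close> and \<open>y\<close> is a diameter of \<open>K\<close>; the constant
  \<open>diameter\<close> on the right is the numerical diameter of the library.\<close>

definition is_diameter :: "(real^3) set \<Rightarrow> real^3 \<Rightarrow> real^3 \<Rightarrow> bool" where
  "is_diameter K x y \<longleftrightarrow> closed_segment x y \<subseteq> K \<and> dist x y = diameter K"

definition diametral_point :: "(real^3) set \<Rightarrow> real^3 \<Rightarrow> bool" where
  "diametral_point K x \<longleftrightarrow> (\<exists>y. is_diameter K x y)"

end

theory Submission
  imports Defs
begin

text \<open>
  A closed curve on the unit sphere is at least as long as the spherical triangle spanned by any
  three of its points. Pushing the vertices of a triangle outwards along great circles until they
  hit the tangent cone does not decrease its perimeter, so for \<open>a\<close>, \<open>b\<close>, \<open>c\<close> in \<open>K\<close> the three angles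
  at \<open>x\<close> between the directions to \<open>a\<close>, \<open>b\<close>, \<open>c\<close> add up to at most the complete angle at \<open>x\<close>;
  with \<open>b = c\<close> every angle at \<open>x\<close> is at most half of it. Part (i) is then the law of cosines.
  For (ii), let \<open>zw\<close> be a diameter of length \<open>D\<close> and suppose that \<open>x\<close> and \<open>y\<close> are not diametral. The
  angles \<open>a\<close>, \<open>b\<close> subtended by \<open>zw\<close> at \<open>x\<close>, \<open>y\<close> exceed \<open>\<pi>/3\<close> and \<open>a + b \<le> 3\<pi>/4\<close>. Adding the two
  perimeters and using the angle sums of \<open>xyz\<close> and \<open>xyw\<close>, the angle \<open>xzy\<close> or \<open>xwy\<close> is
  not acute, say at \<open>z\<close>. As \<open>|xz| \<ge> 2 D cos a\<close> and \<open>|yz| \<ge> 2 D cos b\<close>, this forces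
  \<open>|xy|\<^sup>2 \<ge> 4 D\<^sup>2 (cos\<^sup>2 a + cos\<^sup>2 b) > D\<^sup>2\<close>. Part (iii) reduces to (ii) for the pair with the smallest sum.
\<close>

section \<open>Angles between vectors and their triangle inequality\<close>

text \<open>If one vector is 0, division by zero makes the value \<open>arccos 0\<close>, that is
  pi/2. With this convention the bounds, the cosine formula for the inner product and the rule for
  \<open>- v\<close> hold without side conditions; \<open>vangle_self\<close> still asks for a
  nonzero vector.\<close>

definition vangle :: "'a::real_inner \<Rightarrow> 'a \<Rightarrow> real" where
  "vangle u v = arccos (u \<bullet> v / (norm u * norm v))"

lemma vangle_arg_bounds: "\<bar>u \<bullet> v / (norm u * norm v)\<bar> \<le> 1"
proof (cases "u = 0 \<or> v = 0")
  case False
  then show ?thesis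
    using Cauchy_Schwarz_ineq2[of u v] by (simp add: abs_mult divide_le_eq)
qed auto

lemma vangle_ge_0: "0 \<le> vangle u v" and vangle_le_pi: "vangle u v \<le> pi"
  unfolding vangle_def using vangle_arg_bounds[of u v]
  by (intro arccos_lbound arccos_ubound; linarith)+

lemma inner_eq_cos_vangle: "u \<bullet> v = norm u * norm v * cos (vangle u v)"
proof -
  have "cos (vangle u v) = u \<bullet> v / (norm u * norm v)"
    using vangle_arg_bounds[of u v] by (simp add: vangle_def cos_arccos_abs)
  then show ?thesis by (cases "u = 0 \<or> v = 0") auto
qed

lemma vangle_commute: "vangle u v = vangle v u"
  by (simp add: vangle_def inner_commute mult.commute)

lemma vangle_minus_right: "vangle u (- v) = pi - vangle u v"
proof -
  have "- 1 \<le> u \<bullet> v / (norm u * norm v)" "u \<bullet> v / (norm u * norm v) \<le> 1"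
    using vangle_arg_bounds[of u v] by linarith+
  then show ?thesis by (simp add: vangle_def arccos_minus)
qed

lemma vangle_minus_minus [simp]: "vangle (- u) (- v) = vangle u v"
  by (simp add: vangle_def)

lemma vangle_self: "u \<noteq> 0 \<Longrightarrow> vangle u u = 0"
  by (simp add: vangle_def power2_eq_square[symmetric] power2_norm_eq_inner)

lemma vangle_sgn [simp]: "vangle (sgn u) (sgn v) = vangle u v"
  by (cases "u = 0 \<or> v = 0") (auto simp: vangle_def sgn_div_norm field_simps)

lemma vangle_eqI:
  assumes "norm u = 1" "norm v = 1" "0 \<le> t" "t \<le> pi" "u \<bullet> v = cos t"
  shows "vangle u v = t"
  using assms by (simp add: vangle_def arccos_cos)

text \<open>Gram-Schmidt: \<open>n\<close> is the normalized component of \<open>u\<close>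
  orthogonal to \<open>v\<close>. If that component vanishes, \<open>u\<close> is \<open>v\<close>
  or \<open>- v\<close>, and dimension at least 2 supplies some orthogonal direction. The result
  parametrizes a great circle through \<open>v\<close> and \<open>u\<close>.\<close>

lemma vangle_orthogonal_decomposition:
  fixes u v :: "'a::euclidean_space"
  assumes "2 \<le> DIM('a)" "norm u = 1" "norm v = 1"
  obtains n where "norm n = 1" "v \<bullet> n = 0" "u = cos (vangle v u) *\<^sub>R v + sin (vangle v u) *\<^sub>R n"
proof -
  define c where "c = cos (vangle v u)"
  define w where "w = u - c *\<^sub>R v"
  have vu: "v \<bullet> u = c" using inner_eq_cos_vangle[of v u] assms by (simp add: c_def)
  have uu: "u \<bullet> u = 1" "v \<bullet> v = 1" using assms by (simp_all add: dot_square_norm)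
  have vw: "v \<bullet> w = 0" using vu uu by (simp add: w_def inner_diff_right)
  have s0: "sin (vangle v u) \<ge> 0" by (simp add: vangle_ge_0 vangle_le_pi sin_ge_zero)
  have "(norm w)\<^sup>2 = 1 - c\<^sup>2"
    unfolding power2_norm_eq_inner using vu uu
    by (simp add: w_def inner_diff_right inner_diff_left inner_commute[of u v] power2_eq_square)
  also have "\<dots> = (sin (vangle v u))\<^sup>2" by (simp add: c_def sin_squared_eq)
  finally have nw: "norm w = sin (vangle v u)" using s0 by (simp add: power2_eq_iff_nonneg)
  show ?thesis
  proof (cases "w = 0")
    case True
    obtain y where y: "y \<noteq> 0" "orthogonal v y"
      using orthogonal_to_vector_exists[OF assms(1), of v] by blast
    show ?thesis
      by (rule that[of "sgn y"]) (use y True nw in \<open>auto simp: norm_sgn orthogonal_def sgn_div_norm w_def c_def\<close>)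
  next
    case False
    show ?thesis
      by (rule that[of "sgn w"])
        (use False vw nw in \<open>auto simp: norm_sgn sgn_div_norm nw[symmetric]\<close>, simp add: w_def c_def)
  qed
qed

text \<open>The components of \<open>u\<close> and \<open>w\<close> orthogonal to \<open>v\<close>
  have norms \<open>sin ?a\<close> and \<open>sin ?b\<close>. Cauchy-Schwarz for them bounds the
  cosine of the third angle below by \<open>cos (?a + ?b)\<close>, and cosine decreases on [0, pi].
  A sum above pi is trivial.\<close>

lemma vangle_triangle_unit:
  fixes u v w :: "'a::real_inner"
  assumes "norm u = 1" "norm v = 1" "norm w = 1"
  shows "vangle u w \<le> vangle u v + vangle v w"
proof (cases "vangle u v + vangle v w \<le> pi")
  case True
  let ?a = "vangle u v" and ?b = "vangle v w"
  define u' w' where "u' = u - cos ?a *\<^sub>R v" and "w' = w - cos ?b *\<^sub>R v"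
  have i: "u \<bullet> u = 1" "v \<bullet> v = 1" "w \<bullet> w = 1" "u \<bullet> v = cos ?a" "v \<bullet> w = cos ?b" "u \<bullet> w = cos (vangle u w)"
    using assms inner_eq_cos_vangle[of u v] inner_eq_cos_vangle[of v w] inner_eq_cos_vangle[of u w]
    by (simp_all add: dot_square_norm)
  have "(norm u')\<^sup>2 = (sin ?a)\<^sup>2"
    unfolding power2_norm_eq_inner sin_squared_eq using i
    by (simp add: u'_def inner_diff_left inner_diff_right inner_commute[of v u] power2_eq_square)
  then have nu: "norm u' = sin ?a"
    by (simp add: power2_eq_iff_nonneg sin_ge_zero vangle_ge_0 vangle_le_pi)
  have "(norm w')\<^sup>2 = (sin ?b)\<^sup>2"
    unfolding power2_norm_eq_inner sin_squared_eq using i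
    by (simp add: w'_def inner_diff_left inner_diff_right inner_commute[of w v] power2_eq_square)
  then have nw: "norm w' = sin ?b"
    by (simp add: power2_eq_iff_nonneg sin_ge_zero vangle_ge_0 vangle_le_pi)
  have "- (sin ?a * sin ?b) \<le> u' \<bullet> w'"
    using Cauchy_Schwarz_ineq2[of u' w'] nu nw by auto
  also have "u' \<bullet> w' = cos (vangle u w) - cos ?a * cos ?b"
    using i by (simp add: u'_def w'_def inner_diff_left inner_diff_right)
  finally have "cos (?a + ?b) \<le> cos (vangle u w)"
    by (simp add: cos_add)
  then show ?thesis
    using True by (subst (asm) cos_mono_le_eq) (auto simp: vangle_ge_0 vangle_le_pi)
qed (use vangle_le_pi[of u w] in linarith)

lemma vangle_triangle:
  fixes u v w :: "'a::real_inner"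
  assumes "u \<noteq> 0" "v \<noteq> 0" "w \<noteq> 0"
  shows "vangle u w \<le> vangle u v + vangle v w"
  using vangle_triangle_unit[of "sgn u" "sgn v" "sgn w"] assms by (simp add: norm_sgn)

lemma norm_diff_unit_eq_sin_vangle:
  fixes u v :: "'a::real_inner"
  assumes "norm u = 1" "norm v = 1"
  shows "norm (u - v) = 2 * sin (vangle u v / 2)"
proof -
  have "(norm (u - v))\<^sup>2 = 2 - 2 * cos (vangle u v)"
    using assms inner_eq_cos_vangle[of u v] dot_norm_neg[of u v] by simp
  also have "\<dots> = (2 * sin (vangle u v / 2))\<^sup>2"
    using cos_double_sin[of "vangle u v / 2"] by (simp add: power_mult_distrib)
  finally show ?thesis
    using vangle_ge_0[of u v] vangle_le_pi[of u v]
    by (subst (asm) power2_eq_iff_nonneg) (auto intro!: sin_ge_zero)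
qed

section \<open>Lengths of closed curves on the unit sphere\<close>

text \<open>On the unit sphere an arc of length \<open>x\<close> has chord
  \<open>2 * sin (x / 2)\<close>, and chord over arc tends to 1. Thus short arcs can be traded for
  chords at the cost of a factor \<open>c < 1\<close>.\<close>

lemma arc_le_chord_near_0:
  fixes c :: real
  assumes "c < 1"
  obtains d where "0 < d" "\<And>x. 0 \<le> x \<Longrightarrow> x < d \<Longrightarrow> c * x \<le> 2 * sin (x / 2)"
proof -
  have "((\<lambda>x::real. 2 * sin (x / 2)) has_real_derivative 1) (at 0)"
    by (auto intro!: derivative_eq_intros)
  then have "((\<lambda>x::real. 2 * sin (x / 2) / x) \<longlongrightarrow> 1) (at_right 0)"
    by (auto simp: has_field_derivative_iff intro: tendsto_mono[OF at_le])
  then have "\<forall>\<^sub>F x in at_right 0. c < 2 * sin (x / 2) / x"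
    using assms by (simp add: order_tendstoD)
  then obtain d where d: "0 < d" "\<And>x. 0 < x \<Longrightarrow> x < d \<Longrightarrow> c < 2 * sin (x / 2) / x"
    unfolding eventually_at_right_field by (metis)
  show ?thesis
    by (rule that[OF d(1)]) (metis d(2) le_less less_divide_eq mult_zero_right div_0 sin_zero order_refl)
qed

lemma vangle_le_sum:
  fixes f :: "nat \<Rightarrow> 'a::real_inner"
  assumes "i \<le> j" "\<And>k. norm (f k) = 1"
  shows "vangle (f i) (f j) \<le> (\<Sum>k=i..<j. vangle (f k) (f (Suc k)))"
  using assms(1)
proof (induction j rule: dec_induct)
  case base
  show ?case using assms(2)[of i] by (subst vangle_self) auto
next
  case (step j)
  then show ?case
    using vangle_triangle_unit[of "f i" "f j" "f (Suc j)"] assms(2) by simp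
qed

lemma path_length_ge_polygon:
  assumes "n > 0"
  shows "ennreal (\<Sum>i<n. dist (g (real i / real n)) (g (real (Suc i) / real n))) \<le> path_length g"
proof -
  have "mono_on {..n} (\<lambda>i. real i / real n) \<and> (\<lambda>i. real i / real n) ` {..n} \<subseteq> {0..1}"
    using assms by (auto intro!: mono_onI divide_right_mono)
  then show ?thesis
    unfolding path_length_def
    by (intro SUP_upper2[where i = "(n, \<lambda>i. real i / real n)"]) auto
qed

text \<open>The sequence consists of the largest multiples of \<open>1 / n\<close> not exceeding
  \<open>s\<close>; it moves a given parameter onto the uniform grid used for inscribed
  polygons.\<close>

lemma floor_sample_tendsto:
  fixes s :: real
  assumes "0 \<le> s"
  shows "(\<lambda>n. real (nat \<lfloor>real n * s\<rfloor>) / real n) \<longlonglongrightarrow> s"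
proof (rule tendsto_sandwich[OF _ _ _ tendsto_const])
  have "s - 1 / real n \<le> real (nat \<lfloor>real n * s\<rfloor>) / real n \<and> real (nat \<lfloor>real n * s\<rfloor>) / real n \<le> s"
    if "n > 0" for n
  proof -
    have *: "real (nat \<lfloor>real n * s\<rfloor>) = of_int \<lfloor>real n * s\<rfloor>"
      using assms by simp
    have "real n * s - 1 \<le> real (nat \<lfloor>real n * s\<rfloor>)" "real (nat \<lfloor>real n * s\<rfloor>) \<le> real n * s"
      unfolding * by linarith+
    moreover have "s - 1 / real n = (real n * s - 1) / real n" "s = real n * s / real n"
      using that by (simp_all add: field_simps)
    ultimately show ?thesis by (metis divide_right_mono of_nat_0_le_iff)
  qed
  then show "\<forall>\<^sub>F n in sequentially. s - 1 / real n \<le> real (nat \<lfloor>real n * s\<rfloor>) / real n"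
    and "\<forall>\<^sub>F n in sequentially. real (nat \<lfloor>real n * s\<rfloor>) / real n \<le> s"
    by (auto intro!: eventually_sequentiallyI[of 1])
  show "(\<lambda>n. s - 1 / real n) \<longlonglongrightarrow> s"
    using tendsto_diff[OF tendsto_const[of s] lim_1_over_n] by simp
qed

lemma continuous_on_vangle:
  fixes f h :: "'a::topological_space \<Rightarrow> 'b::real_inner"
  assumes "continuous_on S f" "continuous_on S h" "\<And>x. x \<in> S \<Longrightarrow> f x \<noteq> 0" "\<And>x. x \<in> S \<Longrightarrow> h x \<noteq> 0"
  shows "continuous_on S (\<lambda>x. vangle (f x) (h x))"
proof -
  have "- 1 \<le> f x \<bullet> h x / (norm (f x) * norm (h x)) \<and> f x \<bullet> h x / (norm (f x) * norm (h x)) \<le> 1" for x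
    using vangle_arg_bounds[of "f x" "h x"] by linarith
  then show ?thesis
    unfolding vangle_def using assms by (intro continuous_intros) auto
qed

text \<open>Sample the curve on a uniform grid. For a fine mesh, \<open>c\<close> times the angle
  between neighbours is at most their chord, and the triangle inequality bounds the perimeter at the
  sampled points by the sum of these angles. Then the mesh tends to 0, and finally \<open>c\<close>
  to 1.\<close>

lemma closed_path_length_ge_perimeter:
  fixes g :: "real \<Rightarrow> 'a::real_inner"
  assumes "path g" "pathfinish g = pathstart g" "path_image g \<subseteq> sphere p 1"
    and rst: "0 \<le> r" "r \<le> s" "s \<le> t" "t \<le> 1"
  defines "\<alpha> \<equiv> \<lambda>a b. vangle (g a - p) (g b - p)"
  shows "ennreal (\<alpha> r s + \<alpha> s t + \<alpha> t r) \<le> path_length g"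
proof (cases "path_length g = top")
  case False
  then obtain L where L: "0 \<le> L" "path_length g = ennreal L"
    by (cases "path_length g") auto
  define f where "f = (\<lambda>x. g x - p)"
  have cf: "continuous_on {0..1} f"
    using assms(1) unfolding f_def path_def by (intro continuous_intros)
  have f1: "norm (f x) = 1" if "x \<in> {0..1}" for x
  proof -
    have "g x \<in> sphere p 1" using assms(3) that unfolding path_image_def by blast
    then show ?thesis by (simp add: f_def dist_norm norm_minus_commute)
  qed
  then have f0: "f x \<noteq> 0" if "x \<in> {0..1}" for x
    using that by fastforce
  have \<alpha>: "\<alpha> a b = vangle (f a) (f b)" for a b
    by (simp add: \<alpha>_def f_def)
  have f01: "f 1 = f 0"
    using assms(2) by (simp add: f_def pathfinish_def pathstart_def)
  have "continuous_on ({0..1} \<times> {0..1}) (\<lambda>z. vangle (f (fst z)) (f (snd z)))"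
    by (intro continuous_on_vangle continuous_on_compose2[OF cf] continuous_intros) (auto simp: f0)
  then have c\<alpha>: "continuous_on ({0..1} \<times> {0..1}) (\<lambda>z. \<alpha> (fst z) (snd z))"
    by (simp add: \<alpha>)
  have uc: "uniformly_continuous_on ({0..1} \<times> {0..1}) (\<lambda>z. \<alpha> (fst z) (snd z))"
    by (rule compact_uniformly_continuous[OF c\<alpha>]) (intro compact_Times; simp)
  define q where "q = (\<lambda>n x. real (nat \<lfloor>real n * x\<rfloor>) / real n)"
  have q01: "q n x \<in> {0..1}" if "x \<in> {0..1}" "n > 0" for n x
  proof -
    have "real (nat \<lfloor>real n * x\<rfloor>) \<le> real n * x" using that by simp
    also have "\<dots> \<le> real n" using that by (simp add: mult_left_le)
    finally show ?thesis using that by (simp add: q_def)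
  qed
  have lim: "(\<lambda>n. \<alpha> (q n x) (q n y)) \<longlonglongrightarrow> \<alpha> x y" if "x \<in> {0..1}" "y \<in> {0..1}" for x y
  proof -
    have "(\<lambda>n. (q n x, q n y)) \<longlonglongrightarrow> (x, y)"
      unfolding q_def using that by (intro tendsto_Pair floor_sample_tendsto) auto
    moreover have "\<forall>\<^sub>F n in sequentially. (q n x, q n y) \<in> {0..1} \<times> {0..1}"
      by (rule eventually_sequentiallyI[of 1]) (use q01 that in auto)
    ultimately show ?thesis
      using continuous_on_tendsto_compose[OF c\<alpha>, of "\<lambda>n. (q n x, q n y)" "(x, y)" sequentially]
        that by simp
  qed
  have "c * (\<alpha> r s + \<alpha> s t + \<alpha> t r) \<le> L" if c: "0 < c" "c < 1" for c
  proof -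
    obtain d where d: "0 < d" "\<And>x. 0 \<le> x \<Longrightarrow> x < d \<Longrightarrow> c * x \<le> 2 * sin (x / 2)"
      using arc_le_chord_near_0[OF c(2)] by blast
    obtain e where e: "0 < e" "\<And>x y. x \<in> {0..1} \<Longrightarrow> y \<in> {0..1} \<Longrightarrow> dist x y < e \<Longrightarrow> \<alpha> x y < d"
    proof -
      obtain e where e: "0 < e" "\<And>z z'. z \<in> {0..1} \<times> {0..1} \<Longrightarrow> z' \<in> {0..1} \<times> {0..1} \<Longrightarrow>
          dist z' z < e \<Longrightarrow> dist (\<alpha> (fst z') (snd z')) (\<alpha> (fst z) (snd z)) < d"
        using uc d(1) unfolding uniformly_continuous_on_def by metis
      show ?thesis
      proof (rule that[OF e(1)])
        fix x y :: real assume xy: "x \<in> {0..1}" "y \<in> {0..1}" "dist x y < e"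
        \<comment> \<open>The pair is compared with \<open>(x, x)\<close>, where the angle is 0; so
          uniform continuity makes angles between nearby parameters small.\<close>
        have "dist (x, y) (x, x) < e" using xy by (simp add: dist_Pair_Pair dist_commute)
        then have "dist (\<alpha> x y) (\<alpha> x x) < d" using e(2)[of "(x, x)" "(x, y)"] xy by simp
        then show "\<alpha> x y < d" using f0[of x] xy by (simp add: \<alpha> vangle_self dist_norm)
      qed
    qed
    have bound: "c * (\<alpha> (q n r) (q n s) + \<alpha> (q n s) (q n t) + \<alpha> (q n t) (q n r)) \<le> L"
      if n: "n > 0" "1 / e < real n" for n
    proof -
      \<comment> \<open>Capping the index at \<open>n\<close> keeps \<open>h\<close> a unit vector
        for every natural number, as \<open>vangle_le_sum\<close> demands.\<close>
      define h where "h = (\<lambda>i. f (real (min i n) / real n))"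
      define S where "S = (\<lambda>i j. \<Sum>k=i..<j. vangle (h k) (h (Suc k)))"
      define i j k where "i = nat \<lfloor>real n * r\<rfloor>" and "j = nat \<lfloor>real n * s\<rfloor>" and "k = nat \<lfloor>real n * t\<rfloor>"
      have h1: "norm (h m) = 1" for m
        unfolding h_def by (rule f1) (use n in auto)
      have "i \<le> j" "j \<le> k"
        unfolding i_def j_def k_def using rst by (auto intro!: nat_mono floor_mono mult_left_mono)
      have "real k \<le> real n * t" using rst by (simp add: k_def)
      also have "\<dots> \<le> real n" using rst by (simp add: mult_left_le)
      finally have "k \<le> n" by simp
      have hq: "h i = f (q n r)" "h j = f (q n s)" "h k = f (q n t)"
        using \<open>i \<le> j\<close> \<open>j \<le> k\<close> \<open>k \<le> n\<close> by (auto simp: h_def q_def i_def j_def k_def min_absorb1)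
      have hn: "h n = h 0" using n f01 by (simp add: h_def)
      have "\<alpha> (q n r) (q n s) + \<alpha> (q n s) (q n t) + \<alpha> (q n t) (q n r)
          = vangle (h i) (h j) + vangle (h j) (h k) + vangle (h k) (h i)"
        by (simp add: \<alpha> hq)
      \<comment> \<open>The side from \<open>h k\<close> back to \<open>h i\<close> is routed
        through the base point \<open>h n = h 0\<close>, where the curve closes up.\<close>
      also have "\<dots> \<le> vangle (h i) (h j) + vangle (h j) (h k) + (vangle (h k) (h n) + vangle (h 0) (h i))"
        using vangle_triangle_unit[of "h k" "h 0" "h i"] h1 by (simp add: hn)
      also have "\<dots> \<le> S i j + S j k + (S k n + S 0 i)"
        unfolding S_def using \<open>i \<le> j\<close> \<open>j \<le> k\<close> \<open>k \<le> n\<close> h1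
        by (intro add_mono vangle_le_sum) auto
      also have "\<dots> = S 0 n"
      proof -
        have concat: "S l m + S m l' = S l l'" if "l \<le> m" "m \<le> l'" for l m l'
          unfolding S_def using that by (rule sum.atLeastLessThan_concat)
        show ?thesis
          using concat[of 0 i n] concat[of i j n] concat[of j k n] \<open>i \<le> j\<close> \<open>j \<le> k\<close> \<open>k \<le> n\<close> by simp
      qed
      finally have "c * (\<alpha> (q n r) (q n s) + \<alpha> (q n s) (q n t) + \<alpha> (q n t) (q n r)) \<le> c * S 0 n"
        using c by (simp add: mult_left_mono)
      also have "\<dots> \<le> (\<Sum>m<n. dist (g (real m / real n)) (g (real (Suc m) / real n)))"
        unfolding S_def sum_distrib_left atLeast0LessThan
      proof (rule sum_mono)
        fix m assume m: "m \<in> {..<n}"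
        have *: "real m / real n \<in> {0..1}" "real (Suc m) / real n \<in> {0..1}" using m by auto
        have hm: "h m = f (real m / real n)" "h (Suc m) = f (real (Suc m) / real n)"
          using m by (auto simp: h_def min_absorb1)
        have "dist (real m / real n) (real (Suc m) / real n) = 1 / real n"
          using n by (simp add: dist_real_def field_simps)
        also have "\<dots> < e" using n e(1) by (simp add: field_simps)
        finally have "vangle (h m) (h (Suc m)) < d"
          using e(2)[OF *] by (simp add: \<alpha> hm)
        then have "c * vangle (h m) (h (Suc m)) \<le> norm (h m - h (Suc m))"
          using d(2) vangle_ge_0 norm_diff_unit_eq_sin_vangle[OF h1 h1] by metis
        then show "c * vangle (h m) (h (Suc m)) \<le> dist (g (real m / real n)) (g (real (Suc m) / real n))"
          by (simp add: hm f_def dist_norm)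
      qed
      also have "\<dots> \<le> L"
        using path_length_ge_polygon[OF n(1), of g] L by simp
      finally show ?thesis .
    qed
    obtain N where N: "1 / e < real N" using reals_Archimedean2 by blast
    have "(\<lambda>n. c * (\<alpha> (q n r) (q n s) + \<alpha> (q n s) (q n t) + \<alpha> (q n t) (q n r)))
        \<longlonglongrightarrow> c * (\<alpha> r s + \<alpha> s t + \<alpha> t r)"
      using rst by (intro tendsto_intros lim) auto
    then show ?thesis
    proof (rule tendsto_upperbound)
      show "\<forall>\<^sub>F n in sequentially. c * (\<alpha> (q n r) (q n s) + \<alpha> (q n s) (q n t) + \<alpha> (q n t) (q n r)) \<le> L"
        by (rule eventually_sequentiallyI[of "Suc N"]) (use N in \<open>auto intro!: bound\<close>)
    qed simp
  qed
  then show ?thesis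
    unfolding L(2) by (blast intro: ennreal_leI field_le_mult_one_interval)
qed simp

text \<open>The infimum is bounded one parametrization at a time. Each meets the three points in one
  of six orders, and the perimeter is symmetric in them.\<close>

lemma jordan_curve_length_ge_perimeter:
  fixes C :: "'a::real_inner set"
  assumes "C \<subseteq> sphere p 1" "u \<in> C" "v \<in> C" "w \<in> C"
  shows "ennreal (vangle (u - p) (v - p) + vangle (v - p) (w - p) + vangle (w - p) (u - p))
    \<le> jordan_curve_length C"
  unfolding jordan_curve_length_def
proof (rule INF_greatest)
  fix g assume "g \<in> {g. simple_path g \<and> pathfinish g = pathstart g \<and> path_image g = C}"
  then have g: "path g" "pathfinish g = pathstart g" "path_image g = C"
    by (auto dest: simple_path_imp_path)
  then obtain r s t where "r \<in> {0..1}" "s \<in> {0..1}" "t \<in> {0..1}" "u = g r" "v = g s" "w = g t"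
    using assms by (auto simp: path_image_def)
  moreover have "r \<le> s \<and> s \<le> t \<or> r \<le> t \<and> t \<le> s \<or> s \<le> r \<and> r \<le> t \<or> s \<le> t \<and> t \<le> r
      \<or> t \<le> r \<and> r \<le> s \<or> t \<le> s \<and> s \<le> r"
    by linarith
  moreover note per = closed_path_length_ge_perimeter[OF g(1,2), of p]
  ultimately show "ennreal (vangle (u - p) (v - p) + vangle (v - p) (w - p) + vangle (w - p) (u - p))
      \<le> path_length g"
    using g(3) assms(1) per[of r s t] per[of r t s] per[of s r t] per[of s t r] per[of t r s] per[of t s r]
    by (auto simp: vangle_commute add_ac)
qed

section \<open>Spherical triangles inside the tangent cone\<close>

text \<open>Follow the great half-circle from \<open>v\<close> through \<open>u\<close> to
  \<open>- v\<close>. At \<open>u\<close> it is in \<open>S\<close>, at the end it is not in the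
  interior, so it meets the frontier at or after \<open>u\<close>. Angles add along an arc of length
  at most pi.\<close>

lemma extend_to_frontier:
  fixes S :: "'a::euclidean_space set"
  assumes dim: "2 \<le> DIM('a)" and S: "closed S"
    and u: "norm u = 1" "p + u \<in> S" and v: "norm v = 1" "p - v \<notin> interior S"
  obtains u' where "norm u' = 1" "p + u' \<in> frontier S" "vangle v u' = vangle v u + vangle u u'"
proof -
  define \<theta> where "\<theta> = vangle v u"
  have \<theta>: "0 \<le> \<theta>" "\<theta> \<le> pi" by (simp_all add: \<theta>_def vangle_ge_0 vangle_le_pi)
  obtain n where n: "norm n = 1" "v \<bullet> n = 0" "u = cos \<theta> *\<^sub>R v + sin \<theta> *\<^sub>R n"
    using vangle_orthogonal_decomposition[OF dim u(1) v(1)] unfolding \<theta>_def by blast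
  define e where "e = (\<lambda>a. cos a *\<^sub>R v + sin a *\<^sub>R n)"
  have vn: "v \<bullet> v = 1" "n \<bullet> n = 1" "n \<bullet> v = 0" using n v by (auto simp: dot_square_norm inner_commute)
  have ee: "e a \<bullet> e b = cos (b - a)" for a b
    using vn n(2) by (simp add: e_def inner_add_left inner_add_right cos_diff)
  have e1: "norm (e a) = 1" for a
    using ee[of a a] by (simp add: norm_eq_sqrt_inner)
  have ang: "vangle (e a) (e b) = b - a" if "a \<le> b" "b - a \<le> pi" for a b
    using that by (intro vangle_eqI e1) (auto simp: ee)
  have e0: "e 0 = v" and epi: "e pi = - v" and eu: "e \<theta> = u" by (auto simp: e_def n)
  obtain a where a: "a \<in> {\<theta>..pi}" "p + e a \<in> frontier S"
  \<comment> \<open>If the endpoint itself lies in \<open>S\<close>, it is a frontier point, being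
    not interior; otherwise the arc leaves \<open>S\<close> and connectedness applies.\<close>
  proof (cases "p - v \<in> S")
    case True
    then have "p + e pi \<in> frontier S" using v S by (simp add: epi frontier_def)
    then show ?thesis using \<theta> by (intro that) auto
  next
    case False
    have "connected ((\<lambda>a. p + e a) ` {\<theta>..pi})"
      unfolding e_def by (intro connected_continuous_image continuous_intros connected_Icc)
    moreover have "p + e \<theta> \<in> (\<lambda>a. p + e a) ` {\<theta>..pi} \<inter> S" using \<theta> u eu by auto
    moreover have "p + e pi \<in> (\<lambda>a. p + e a) ` {\<theta>..pi} - S"
      using \<theta> False by (intro DiffI imageI) (auto simp: epi)
    ultimately have "(\<lambda>a. p + e a) ` {\<theta>..pi} \<inter> frontier S \<noteq> {}"
      by (intro connected_Int_frontier) blast+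
    then show ?thesis using that by blast
  qed
  show ?thesis
  proof (rule that[OF e1 a(2)])
    show "vangle v (e a) = vangle v u + vangle u (e a)"
      using ang[of 0 a] ang[of \<theta> a] ang[of 0 \<theta>] a \<theta> by (simp add: e0 eu)
  qed
qed

text \<open>One side grows by exactly \<open>vangle u u'\<close>, while the side towards
  \<open>w\<close> shrinks by at most that much.\<close>

lemma perimeter_le_of_extend:
  fixes u u' v w :: "'a::real_inner"
  assumes "norm u = 1" "norm u' = 1" "norm w = 1" "vangle v u' = vangle v u + vangle u u'"
  shows "vangle u v + vangle v w + vangle w u \<le> vangle u' v + vangle v w + vangle w u'"
  using vangle_triangle_unit[of w u' u] assms by (simp add: vangle_commute)

lemma perimeter_le_complete_angle:
  fixes K :: "(real^3) set"
  assumes K: "convex_body K" and x: "x \<in> frontier K"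
    and abc: "a \<in> K" "b \<in> K" "c \<in> K" "a \<noteq> x" "b \<noteq> x" "c \<noteq> x"
  shows "ennreal (vangle (a - x) (b - x) + vangle (b - x) (c - x) + vangle (c - x) (a - x))
    \<le> complete_angle K x"
proof -
  define S where "S = closure {x + t *\<^sub>R (q - x) | q t. q \<in> K \<and> 0 \<le> t}"
  have "convex K" "x \<in> closure K" "x \<notin> interior K" "interior K \<noteq> {}"
    using K x by (auto simp: convex_body_def frontier_def)
  \<comment> \<open>\<open>n\<close> is an inward normal of a supporting plane at \<open>x\<close>;
    its half-space will contain the whole cone \<open>S\<close>.\<close>
  then obtain n where n: "n \<noteq> 0" "\<And>q. q \<in> closure K \<Longrightarrow> n \<bullet> x \<le> n \<bullet> q"
    using supporting_hyperplane_relative_frontier[of K x] by (metis interior_rel_interior_gen rel_interior_nonempty_interior)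
  have nK: "n \<bullet> x \<le> n \<bullet> q" if "q \<in> K" for q using n(2) that closure_subset by blast
  have sub: "S \<subseteq> {z. n \<bullet> z \<ge> n \<bullet> x}"
    unfolding S_def
  proof (rule closure_minimal)
    show "{x + t *\<^sub>R (q - x) | q t. q \<in> K \<and> 0 \<le> t} \<subseteq> {z. n \<bullet> z \<ge> n \<bullet> x}"
      using nK by (auto simp: inner_add_right inner_diff_right)
  qed (rule closed_halfspace_ge)
  \<comment> \<open>An interior point of \<open>S\<close> lies strictly on the positive side of the
    plane, so its reflection in \<open>x\<close> lies strictly on the negative side, outside
    \<open>S\<close>.\<close>
  have opp: "x - v \<notin> interior S" if "x + v \<in> S" for v
  proof
    assume "x - v \<in> interior S"
    then have "x - v \<in> {z. n \<bullet> z > n \<bullet> x}"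
      using interior_mono[OF sub] interior_halfspace_ge[OF n(1)] by blast
    moreover have "n \<bullet> (x + v) \<ge> n \<bullet> x" using sub that by auto
    ultimately show False by (simp add: inner_diff_right inner_add_right)
  qed
  have dir: "x + sgn (q - x) \<in> S" "norm (sgn (q - x)) = 1" if "q \<in> K" "q \<noteq> x" for q
  proof -
    have "x + sgn (q - x) = x + inverse (norm (q - x)) *\<^sub>R (q - x)" by (simp add: sgn_div_norm)
    then show "x + sgn (q - x) \<in> S"
      unfolding S_def using that by (intro subsetD[OF closure_subset]) (auto intro!: exI[of _ q])
    show "norm (sgn (q - x)) = 1" using that by (simp add: norm_sgn)
  qed
  have S: "closed S" "frontier S \<subseteq> S" by (auto simp: S_def frontier_def)
  have dim: "2 \<le> DIM(real^3)" by simp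
  define u v w where "u = sgn (a - x)" and "v = sgn (b - x)" and "w = sgn (c - x)"
  have uvw: "x + u \<in> S" "x + v \<in> S" "x + w \<in> S" "norm u = 1" "norm v = 1" "norm w = 1"
    using dir abc by (auto simp: u_def v_def w_def)
  \<comment> \<open>The vertices move one after the other: \<open>u\<close> away from
    \<open>v\<close>, \<open>v\<close> away from \<open>w\<close>, and \<open>w\<close> away from
    the already moved \<open>u'\<close>. No move decreases the perimeter.\<close>
  obtain u' where u': "norm u' = 1" "x + u' \<in> frontier S" "vangle v u' = vangle v u + vangle u u'"
    using extend_to_frontier[OF dim S(1), of u x v] uvw opp by blast
  obtain v' where v': "norm v' = 1" "x + v' \<in> frontier S" "vangle w v' = vangle w v + vangle v v'"
    using extend_to_frontier[OF dim S(1), of v x w] uvw opp by blast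
  obtain w' where w': "norm w' = 1" "x + w' \<in> frontier S" "vangle u' w' = vangle u' w + vangle w w'"
    using extend_to_frontier[OF dim S(1), of w x u'] uvw opp u' S by blast
  have "vangle (a - x) (b - x) + vangle (b - x) (c - x) + vangle (c - x) (a - x)
      = vangle u v + vangle v w + vangle w u"
    by (simp add: u_def v_def w_def)
  also have "\<dots> \<le> vangle u' v + vangle v w + vangle w u'"
    by (rule perimeter_le_of_extend) (use uvw u' in auto)
  also have "\<dots> = vangle v w + vangle w u' + vangle u' v" by simp
  also have "\<dots> \<le> vangle v' w + vangle w u' + vangle u' v'"
    by (rule perimeter_le_of_extend) (use uvw u' v' in auto)
  also have "\<dots> = vangle w u' + vangle u' v' + vangle v' w" by simp
  also have "\<dots> \<le> vangle w' u' + vangle u' v' + vangle v' w'"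
    by (rule perimeter_le_of_extend) (use uvw v' w' in auto)
  also have "ennreal \<dots> \<le> complete_angle K x"
    unfolding complete_angle_def tangent_cone_def S_def[symmetric]
    using jordan_curve_length_ge_perimeter[of "frontier S \<inter> sphere x 1" x "x + w'" "x + u'" "x + v'"]
      u' v' w' by (simp add: dist_norm)
  finally show ?thesis by (simp add: ennreal_leI)
qed

section \<open>Angles and distances in triangles\<close>

lemma law_of_cosines:
  fixes x a b :: "'a::real_inner"
  shows "(dist a b)\<^sup>2 = (dist x a)\<^sup>2 + (dist x b)\<^sup>2 - 2 * dist x a * dist x b * cos (vangle (a - x) (b - x))"
proof -
  have "(dist a b)\<^sup>2 = (norm ((a - x) - (b - x)))\<^sup>2" by (simp add: dist_norm)
  also have "\<dots> = (norm (a - x))\<^sup>2 + (norm (b - x))\<^sup>2 - 2 * ((a - x) \<bullet> (b - x))"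
    unfolding power2_norm_eq_inner by (simp add: inner_diff_left inner_diff_right inner_commute)
  finally show ?thesis
    unfolding inner_eq_cos_vangle by (simp add: dist_norm norm_minus_commute)
qed

text \<open>The exterior angle at \<open>z\<close> is the angle between \<open>z - x\<close> and
  \<open>y - z\<close>; by the triangle inequality through \<open>y - x\<close> it is at most the
  sum of the interior angles at \<open>x\<close> and \<open>y\<close>.\<close>

lemma triangle_angle_sum_ge_pi:
  fixes x y z :: "'a::real_inner"
  assumes "x \<noteq> y" "y \<noteq> z" "x \<noteq> z"
  shows "pi \<le> vangle (y - x) (z - x) + vangle (x - y) (z - y) + vangle (x - z) (y - z)"
proof -
  have "vangle (z - x) (y - z) = pi - vangle (x - z) (y - z)"
    using vangle_minus_right[of "y - z" "x - z"] by (simp add: vangle_commute)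
  moreover have "vangle (y - x) (y - z) = vangle (x - y) (z - y)"
    using vangle_minus_minus[of "x - y" "z - y"] by simp
  ultimately show ?thesis
    using vangle_triangle[of "z - x" "y - x" "y - z"] assms by (simp add: vangle_commute)
qed

text \<open>The cosine is at least 1/2, so the law of cosines bounds the squared opposite side by
  \<open>?s^2 + ?t^2 - ?s * ?t\<close>, which is at most the square of the larger leg.\<close>

lemma dist_le_max_of_vangle_le:
  fixes x a b :: "'a::real_inner"
  assumes "vangle (a - x) (b - x) \<le> pi / 3"
  shows "dist a b \<le> max (dist x a) (dist x b)"
proof -
  let ?s = "dist x a" and ?t = "dist x b"
  have "cos (pi / 3) \<le> cos (vangle (a - x) (b - x))"
    using assms vangle_ge_0 pi_gt_zero by (intro cos_monotone_0_pi_le) auto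
  then have "1 / 2 \<le> cos (vangle (a - x) (b - x))" by (simp add: cos_60)
  then have "?s * ?t * (1 / 2) \<le> ?s * ?t * cos (vangle (a - x) (b - x))"
    by (intro mult_left_mono) auto
  then have le: "(dist a b)\<^sup>2 \<le> ?s\<^sup>2 + ?t\<^sup>2 - ?s * ?t"
    using law_of_cosines[of a b x] by (simp add: algebra_simps)
  have "?s\<^sup>2 + ?t\<^sup>2 - ?s * ?t \<le> (max ?s ?t)\<^sup>2"
  proof (cases "?s \<le> ?t")
    case True
    then have "?s * ?s \<le> ?s * ?t" by (intro mult_left_mono) auto
    then show ?thesis using True by (simp add: power2_eq_square)
  next
    case False
    then have "?t * ?t \<le> ?s * ?t" by (intro mult_right_mono) auto
    then show ?thesis using False by (simp add: power2_eq_square)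
  qed
  with le show ?thesis
    by (meson order_trans power2_le_imp_le max.coboundedI1 zero_le_dist)
qed

text \<open>Equality holds for the isosceles triangle with \<open>dist x w = dist z w\<close>.\<close>
lemma dist_ge_cos_vangle:
  fixes x z w :: "'a::real_inner"
  assumes "x \<noteq> z" "dist x w < dist z w" "pi / 3 \<le> vangle (z - x) (w - x)"
  shows "2 * dist z w * cos (vangle (z - x) (w - x)) \<le> dist x z"
proof (rule ccontr)
  define D s t c where "D = dist z w" and "s = dist x z" and "t = dist x w"
    and "c = cos (vangle (z - x) (w - x))"
  assume "\<not> ?thesis"
  then have s: "0 < s" "s < 2 * D * c" using assms(1) by (auto simp: D_def s_def c_def)
  have t: "0 \<le> t" "t < D" using assms(2) by (auto simp: D_def t_def)
  have "c \<le> cos (pi / 3)"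
    unfolding c_def using assms(3) vangle_le_pi by (intro cos_monotone_0_pi_le) auto
  then have "c \<le> 1 / 2" by (simp add: cos_60)
  then have "D * c \<le> D * (1 / 2)" using t by (intro mult_left_mono) auto
  then have sD: "s < D" using s by simp
  have "D\<^sup>2 = s\<^sup>2 + t * (t - 2 * s * c)"
    using law_of_cosines[of z w x] by (simp add: D_def s_def t_def c_def algebra_simps power2_eq_square)
  \<comment> \<open>Only the inner \<open>t\<close> becomes \<open>D\<close>, as the sign of the new
    bracket is open. If it is nonnegative, the outer \<open>t\<close> may be replaced too and
    \<open>s < 2 * D * c\<close> finishes; otherwise the product is at most 0 and
    \<open>s < D\<close> suffices.\<close>
  also have "\<dots> \<le> s\<^sup>2 + t * (D - 2 * s * c)"
    using t by (intro add_left_mono mult_left_mono) auto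
  also have "\<dots> < D\<^sup>2"
  proof (cases "0 \<le> D - 2 * s * c")
    case True
    have "t * (D - 2 * s * c) \<le> D * (D - 2 * s * c)"
      using True t by (intro mult_right_mono) auto
    moreover have "s * (s - 2 * D * c) < 0" using s by (intro mult_pos_neg) auto
    ultimately show ?thesis by (simp add: power2_eq_square algebra_simps)
  next
    case False
    then have "t * (D - 2 * s * c) \<le> 0" using t by (intro mult_nonneg_nonpos) auto
    moreover have "s\<^sup>2 < D\<^sup>2" using s sD by (intro power_strict_mono) auto
    ultimately show ?thesis by linarith
  qed
  finally show False by simp
qed

text \<open>The sum equals \<open>1 + cos (a + b) * cos (a - b)\<close>, hence is at least
  \<open>1 - \<bar>cos (a + b)\<bar>\<close>. On the given range this absolute value is at most
  \<open>sqrt 2 / 2 < 3 / 4\<close>.\<close>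

lemma cos_squares_gt_quarter:
  assumes "2 * pi / 3 \<le> a + b" "a + b \<le> 3 * pi / 4"
  shows "1 / 4 < (cos a)\<^sup>2 + (cos b)\<^sup>2"
proof -
  have cs: "(cos a)\<^sup>2 + (cos b)\<^sup>2 = 1 + cos (a + b) * cos (a - b)"
  proof -
    have "cos (a + b) * cos (a - b) = (cos a * cos b)\<^sup>2 - (sin a * sin b)\<^sup>2"
      by (simp add: cos_add cos_diff algebra_simps power2_eq_square)
    also have "\<dots> = (cos a)\<^sup>2 * (cos b)\<^sup>2 - (1 - (cos a)\<^sup>2) * (1 - (cos b)\<^sup>2)"
      by (simp add: power_mult_distrib sin_squared_eq)
    finally show ?thesis by (simp add: algebra_simps)
  qed
  have "cos (3 * pi / 4) \<le> cos (a + b)"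
    using assms pi_gt_zero by (intro cos_monotone_0_pi_le) linarith+
  moreover have "cos (3 * pi / 4) = - (sqrt 2 / 2)"
    using cos_minus_pi[of "3 * pi / 4"] cos_minus[of "pi / 4"] by (simp add: cos_45)
  moreover have "cos (a + b) \<le> cos (pi / 2)"
    using assms pi_gt_zero by (intro cos_monotone_0_pi_le) linarith+
  ultimately have "\<bar>cos (a + b)\<bar> \<le> sqrt 2 / 2" by simp
  moreover have "sqrt 2 < 3 / (2::real)" by (rule real_less_lsqrt) (auto simp: power2_eq_square)
  ultimately have "\<bar>cos (a + b)\<bar> < 3 / 4" by simp
  moreover have "\<bar>cos (a + b) * cos (a - b)\<bar> \<le> \<bar>cos (a + b)\<bar>"
    by (simp add: abs_mult mult_left_le)
  ultimately show ?thesis using cs by linarith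
qed

lemma dist_lt_of_obtuse:
  fixes x y z w :: "'a::real_inner"
  assumes "x \<noteq> z" "y \<noteq> z" "dist x w < dist z w" "dist y w < dist z w"
    and a: "pi / 3 \<le> vangle (z - x) (w - x)" and b: "pi / 3 \<le> vangle (z - y) (w - y)"
    and ab: "vangle (z - x) (w - x) + vangle (z - y) (w - y) \<le> 3 * pi / 4"
    and obtuse: "pi / 2 \<le> vangle (x - z) (y - z)"
  shows "dist z w < dist x y"
proof -
  define a b D where "a = vangle (z - x) (w - x)" and "b = vangle (z - y) (w - y)" and "D = dist z w"
  have D: "0 < D" using assms(3) unfolding D_def by (meson le_less_trans zero_le_dist)
  \<comment> \<open>Each angle is at most 3 pi/4 - pi/3 = 5 pi/12. So both cosines are nonnegative
    and the lower bounds on the legs may be squared.\<close>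
  have "a \<le> pi / 2" "b \<le> pi / 2" using assms(5-7) pi_gt_zero unfolding a_def b_def by linarith+
  then have "0 \<le> cos a" "0 \<le> cos b"
    using vangle_ge_0[of "z - x" "w - x"] vangle_ge_0[of "z - y" "w - y"] pi_gt_zero
    unfolding a_def b_def by (intro cos_ge_zero; linarith)+
  moreover have "2 * D * cos a \<le> dist x z" "2 * D * cos b \<le> dist y z"
    using dist_ge_cos_vangle assms unfolding a_def b_def D_def by blast+
  ultimately have "(2 * D * cos a)\<^sup>2 \<le> (dist x z)\<^sup>2" "(2 * D * cos b)\<^sup>2 \<le> (dist y z)\<^sup>2"
    using D by (auto intro!: power_mono)
  then have le: "4 * D\<^sup>2 * ((cos a)\<^sup>2 + (cos b)\<^sup>2) \<le> (dist x z)\<^sup>2 + (dist y z)\<^sup>2"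
    by (simp add: power_mult_distrib algebra_simps)
  have "cos (vangle (x - z) (y - z)) \<le> cos (pi / 2)"
    using obtuse vangle_le_pi pi_gt_zero by (intro cos_monotone_0_pi_le) auto
  then have "dist z x * dist z y * cos (vangle (x - z) (y - z)) \<le> 0"
    by (intro mult_nonneg_nonpos) auto
  then have "(dist x z)\<^sup>2 + (dist y z)\<^sup>2 \<le> (dist x y)\<^sup>2"
    using law_of_cosines[of x y z] by (simp add: dist_commute)
  moreover have "4 * D\<^sup>2 * (1 / 4) < 4 * D\<^sup>2 * ((cos a)\<^sup>2 + (cos b)\<^sup>2)"
    using assms(5-7) D by (intro mult_strict_left_mono cos_squares_gt_quarter) (auto simp: a_def b_def)
  ultimately have "D\<^sup>2 < (dist x y)\<^sup>2" using le by linarith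
  then show ?thesis unfolding D_def by (rule power_less_imp_less_base) simp
qed

lemma two_perimeters_gt:
  fixes x y z w :: "'a::real_inner"
  assumes "x \<noteq> y" "dist x y \<le> dist z w"
    and d: "dist x z < dist z w" "dist x w < dist z w" "dist y z < dist z w" "dist y w < dist z w"
  shows "3 * pi / 2 <
    (vangle (y - x) (z - x) + vangle (z - x) (w - x) + vangle (w - x) (y - x)) +
    (vangle (x - y) (z - y) + vangle (z - y) (w - y) + vangle (w - y) (x - y))"
proof (rule ccontr)
  define a b where "a = vangle (z - x) (w - x)" and "b = vangle (z - y) (w - y)"
  assume "\<not> ?thesis"
  then have le: "(vangle (y - x) (z - x) + a + vangle (w - x) (y - x)) +
    (vangle (x - y) (z - y) + b + vangle (w - y) (x - y)) \<le> 3 * pi / 2"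
    by (simp add: a_def b_def)
  have ne: "x \<noteq> z" "x \<noteq> w" "y \<noteq> z" "y \<noteq> w" using d by (auto simp: dist_commute)
  have a: "pi / 3 < a" and b: "pi / 3 < b"
    using dist_le_max_of_vangle_le[of z x w] dist_le_max_of_vangle_le[of z y w] d
    unfolding a_def b_def by linarith+
  \<comment> \<open>A side of a spherical triangle is at most half its perimeter; doubling and
    adding the bounds for \<open>a\<close> and \<open>b\<close> gives
    \<open>2 * (a + b) \<le> 3 * pi / 2\<close>.\<close>
  have "a \<le> vangle (y - x) (z - x) + vangle (w - x) (y - x)"
    using vangle_triangle[of "z - x" "y - x" "w - x"] ne assms(1) by (simp add: a_def vangle_commute)
  moreover have "b \<le> vangle (x - y) (z - y) + vangle (w - y) (x - y)"
    using vangle_triangle[of "z - y" "x - y" "w - y"] ne assms(1) by (simp add: b_def vangle_commute)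
  ultimately have ab: "a + b \<le> 3 * pi / 4" using le by linarith
  show False
  proof (cases "pi / 2 \<le> vangle (x - z) (y - z)")
    case True
    then have "dist z w < dist x y"
      using ne d a b ab dist_lt_of_obtuse[of x z y w] by (simp add: a_def b_def)
    then show False using assms(2) by simp
  next
    case z: False
    show False
    proof (cases "pi / 2 \<le> vangle (x - w) (y - w)")
      case True
      have "dist w z < dist x y"
        by (rule dist_lt_of_obtuse)
          (use ne d a b ab True in \<open>simp_all add: a_def b_def vangle_commute dist_commute\<close>)
      then show False using assms(2) by (simp add: dist_commute[of w z])
    next
      case False
      \<comment> \<open>With acute angles at \<open>z\<close> and \<open>w\<close>, the other angles
        of the triangles \<open>xyz\<close> and \<open>xyw\<close> sum to more than 2 pi - pi = pi.
        Adding \<open>a + b > 2 * pi / 3\<close> gives more than 5 pi/3, against the bound 3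
        pi/2.\<close>
      then show False
        using triangle_angle_sum_ge_pi[of x y z] triangle_angle_sum_ge_pi[of x y w] z ne assms(1) le a b pi_gt_zero
          vangle_commute[of "y - x" "w - x"] vangle_commute[of "x - y" "w - y"]
        by linarith
    qed
  qed
qed

section \<open>Diametral points of convex bodies\<close>

lemma frontier_in_convex_body: "convex_body K \<Longrightarrow> x \<in> frontier K \<Longrightarrow> x \<in> K"
  unfolding convex_body_def by (metis compact_imp_closed frontier_subset_closed subsetD)

lemma is_diameter_iff:
  assumes "convex_body K" "x \<in> K" "y \<in> K"
  shows "is_diameter K x y \<longleftrightarrow> dist x y = diameter K"
  using assms closed_segment_subset[of x K y] by (auto simp: is_diameter_def convex_body_def)

lemma dist_le_diameter:
  assumes "convex_body K" "x \<in> K" "y \<in> K"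
  shows "dist x y \<le> diameter K"
  using assms unfolding convex_body_def by (metis compact_imp_bounded diameter_bounded_bound)

lemma convex_body_diameter_attained:
  assumes "convex_body K"
  obtains z w where "z \<in> K" "w \<in> K" "dist z w = diameter K"
proof -
  have "compact K" "K \<noteq> {}"
    using assms interior_subset[of K] by (auto simp: convex_body_def)
  then show ?thesis using that diameter_compact_attained by blast
qed

lemma vangle_le_third:
  assumes "convex_body K" "x \<in> frontier K" "complete_angle K x \<le> ennreal (2 * pi / 3)"
    and "a \<in> K" "b \<in> K" "a \<noteq> x" "b \<noteq> x"
  shows "vangle (a - x) (b - x) \<le> pi / 3"
proof -
  \<comment> \<open>For the degenerate triangle with \<open>b\<close> repeated, the perimeter is
    twice the angle.\<close>
  have "ennreal (vangle (a - x) (b - x) + vangle (b - x) (b - x) + vangle (b - x) (a - x)) \<le> ennreal (2 * pi / 3)"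
    using perimeter_le_complete_angle[of K x a b b] assms by (meson order_trans)
  then show ?thesis
    using assms(7) by (simp add: vangle_self vangle_commute[of "b - x" "a - x"])
qed

lemma diametral_of_small_angle:
  assumes K: "convex_body K" and x: "x \<in> frontier K" "complete_angle K x \<le> ennreal (2 * pi / 3)"
  shows "diametral_point K x"
proof -
  have xK: "x \<in> K" using frontier_in_convex_body K x by blast
  obtain z w where zw: "z \<in> K" "w \<in> K" "dist z w = diameter K"
    using convex_body_diameter_attained[OF K] .
  have "dist x z = diameter K \<or> dist x w = diameter K"
  proof (cases "z = x \<or> w = x")
    case False
    then have "dist z w \<le> max (dist x z) (dist x w)"
      using vangle_le_third[OF K x, of z w] zw by (intro dist_le_max_of_vangle_le) auto
    moreover have "dist x z \<le> diameter K" "dist x w \<le> diameter K"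
      using dist_le_diameter[OF K] xK zw by auto
    ultimately show ?thesis using zw by linarith
  qed (use zw in \<open>auto simp: dist_commute\<close>)
  then show ?thesis
    unfolding diametral_point_def using is_diameter_iff[OF K xK] zw by blast
qed

text \<open>Take a diameter \<open>xz\<close>. If \<open>y\<close> differs from \<open>z\<close>,
  the small angle at \<open>y\<close> forces \<open>xy\<close> or \<open>yz\<close> to have full
  length \<open>D\<close>. In the second case the triangle is isosceles with
  \<open>|xz| = |yz| = D\<close>, so \<open>|xy|\<close> is \<open>2 D\<close> times the cosine at
  \<open>x\<close>, which is at least \<open>D\<close>.\<close>

lemma is_diameter_of_small_angles:
  assumes K: "convex_body K" and x: "x \<in> frontier K" "complete_angle K x \<le> ennreal (2 * pi / 3)"
    and y: "y \<in> frontier K" "complete_angle K y \<le> ennreal (2 * pi / 3)" and "x \<noteq> y"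
  shows "is_diameter K x y"
proof -
  have xy: "x \<in> K" "y \<in> K" using frontier_in_convex_body K x y by blast+
  obtain z where "is_diameter K x z"
    using diametral_of_small_angle[OF K x] by (auto simp: diametral_point_def)
  then have z: "z \<in> K" "dist x z = diameter K" by (auto simp: is_diameter_def)
  have le: "dist x y \<le> diameter K" "dist y z \<le> diameter K"
    using dist_le_diameter[OF K] xy z by auto
  have "x \<noteq> z" using z le \<open>x \<noteq> y\<close> by force
  have "dist x y = diameter K"
  proof (cases "y = z")
    case False
    have "dist x z \<le> max (dist y x) (dist y z)"
      by (intro dist_le_max_of_vangle_le vangle_le_third[OF K y]) (use xy z False \<open>x \<noteq> y\<close> in auto)
    then consider "dist x y = diameter K" | "dist y z = diameter K"
      using z le by (fastforce simp: max_def dist_commute split: if_splits)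
    then show ?thesis
    proof cases
      case 2
      let ?c = "cos (vangle (y - x) (z - x))" and ?D = "diameter K"
      have "cos (pi / 3) \<le> ?c"
        by (intro cos_monotone_0_pi_le vangle_ge_0 vangle_le_third[OF K x])
          (use xy z \<open>x \<noteq> y\<close> \<open>x \<noteq> z\<close> in auto)
      then have c: "1 / 2 \<le> ?c" by (simp add: cos_60)
      have D: "0 < ?D" using z \<open>x \<noteq> z\<close> by (metis zero_less_dist_iff)
      have "dist x y * dist x y = dist x y * (2 * ?D * ?c)"
        using law_of_cosines[of y z x, unfolded 2 z(2)] by algebra
      then have "dist x y = 2 * ?D * ?c"
        using \<open>x \<noteq> y\<close> by (metis mult_left_cancel dist_eq_0_iff)
      moreover have "2 * ?D * (1 / 2) \<le> 2 * ?D * ?c" using c D by (intro mult_left_mono) auto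
      ultimately show ?thesis using le by simp
    qed
  qed (use z in simp)
  then show ?thesis using is_diameter_iff[OF K xy] by simp
qed

lemma diametral_of_two_angles:
  assumes K: "convex_body K" and xy: "x \<in> frontier K" "y \<in> frontier K" "x \<noteq> y"
    and sum: "complete_angle K x + complete_angle K y \<le> ennreal (3 * pi / 2)"
  shows "diametral_point K x \<or> diametral_point K y"
proof (rule ccontr)
  assume nd: "\<not> ?thesis"
  have xyK: "x \<in> K" "y \<in> K" using frontier_in_convex_body K xy by blast+
  obtain z w where zw: "z \<in> K" "w \<in> K" "dist z w = diameter K"
    using convex_body_diameter_attained[OF K] .
  \<comment> \<open>Not being diametral means strict inequality to every point of \<open>K\<close>;
    this also separates \<open>x\<close> and \<open>y\<close> from \<open>z\<close> and
    \<open>w\<close>.\<close>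
  have lt: "dist p q < diameter K" if "p \<in> {x, y}" "q \<in> K" for p q
    using that nd is_diameter_iff[OF K, of p q] dist_le_diameter[OF K, of p q] xyK
    unfolding diametral_point_def by (auto simp: le_less)
  have ne: "z \<noteq> x" "z \<noteq> y" "w \<noteq> x" "w \<noteq> y"
    using lt zw by (force simp: dist_commute)+
  let ?P = "vangle (y - x) (z - x) + vangle (z - x) (w - x) + vangle (w - x) (y - x)"
  let ?Q = "vangle (x - y) (z - y) + vangle (z - y) (w - y) + vangle (w - y) (x - y)"
  have "ennreal (?P + ?Q) = ennreal ?P + ennreal ?Q"
    by (intro ennreal_plus add_nonneg_nonneg vangle_ge_0)
  also have "\<dots> \<le> complete_angle K x + complete_angle K y"
    using ne zw xyK xy by (intro add_mono perimeter_le_complete_angle[OF K]) auto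
  finally have "ennreal (?P + ?Q) \<le> ennreal (3 * pi / 2)" using sum by (rule order_trans)
  then have "?P + ?Q \<le> 3 * pi / 2" by (subst (asm) ennreal_le_iff) auto
  moreover have "3 * pi / 2 < ?P + ?Q"
    by (rule two_perimeters_gt) (use xy zw lt dist_le_diameter[OF K] xyK in auto)
  ultimately show False by simp
qed

theorem theorem3p1:
  fixes K :: "(real^3) set"
  assumes "convex_body K"
  shows "(\<forall>x \<in> frontier K. complete_angle K x \<le> ennreal (2 * pi / 3) \<longrightarrow> diametral_point K x) \<and>
    (\<forall>x \<in> frontier K. \<forall>y \<in> frontier K. x \<noteq> y \<longrightarrow>
        complete_angle K x \<le> ennreal (2 * pi / 3) \<longrightarrow>
        complete_angle K y \<le> ennreal (2 * pi / 3) \<longrightarrow> is_diameter K x y) \<and>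
    (\<forall>x \<in> frontier K. \<forall>y \<in> frontier K. x \<noteq> y \<longrightarrow>
        complete_angle K x + complete_angle K y \<le> ennreal (3 * pi / 2) \<longrightarrow>
        diametral_point K x \<or> diametral_point K y) \<and>
    (\<forall>x \<in> frontier K. \<forall>y \<in> frontier K. \<forall>z \<in> frontier K.
        x \<noteq> y \<longrightarrow> y \<noteq> z \<longrightarrow> x \<noteq> z \<longrightarrow>
        complete_angle K x + complete_angle K y + complete_angle K z \<le> ennreal (9 * pi / 4) \<longrightarrow>
        diametral_point K x \<or> diametral_point K y \<or> diametral_point K z)"
proof (intro conjI ballI impI)
  fix x y z assume xyz: "x \<in> frontier K" "y \<in> frontier K" "z \<in> frontier K" "x \<noteq> y" "y \<noteq> z" "x \<noteq> z"
    and sum: "complete_angle K x + complete_angle K y + complete_angle K z \<le> ennreal (9 * pi / 4)"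
  \<comment> \<open>The three pair sums add up to at most 9 pi/2, so one is at most 3 pi/2.
    Finiteness of the total allows the argument to run in the reals.\<close>
  have two_of_three: "a + b \<le> ennreal (3 * pi / 2) \<or> b + c \<le> ennreal (3 * pi / 2) \<or> a + c \<le> ennreal (3 * pi / 2)"
    if "a + b + c \<le> ennreal (9 * pi / 4)" for a b c
  proof -
    have "a + b + c < top" using that by (rule le_less_trans) simp
    then have "a < top" "b < top" "c < top" by auto
    then obtain a' b' c' where "a = ennreal a'" "b = ennreal b'" "c = ennreal c'"
      "0 \<le> a'" "0 \<le> b'" "0 \<le> c'"
      by (metis ennreal_cases less_irrefl)
    then show ?thesis using that by (simp flip: ennreal_plus) linarith
  qed
  show "diametral_point K x \<or> diametral_point K y \<or> diametral_point K z"
    using two_of_three[OF sum] diametral_of_two_angles[OF assms] xyz by blast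
qed (use assms diametral_of_small_angle is_diameter_of_small_angles diametral_of_two_angles in blast)+

end
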